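(* Let $X=\{X(t)\}_{t\ge 0}$ be a minimal random motion moving with velocities $v_0,\dots,v_D\in\mathbb{R}^D$ and whose displacements are governed by a point process $N$. Let $X'=\{X'(t)\}_{t\ge 0}$ be a random motion with velocities $v_0',\dots,v_D'\in\mathbb{R}^D$ whose displacements are governed by a point process $N'\stackrel{d}{=}N$ and with the same rule of changes of velocity as $X$. Then, for $t\ge 0$, $$X'(t)\stackrel{d}{=}f\big(X(t)\big)=\mathrm{V}'\begin{pmatrix}1^T\\ \mathrm{V}\end{pmatrix}^{-1}\begin{pmatrix}t\\ X(t)\end{pmatrix},$$ where $\mathrm{V}=(v_0\ \cdots\ v_D)$ and $\mathrm{V}'=(v_0'\ \cdots\ v_D')$ are the matrices with the velocities as columns and $1^T$ is the row vector of $D+1$ ones. Furthermore, the map $f:\mathbb{R}^D\to\mathbb{R}^D$, $f(x)=\mathrm{V}'\begin{pmatrix}1^T\\ \mathrm{V}\end{pmatrix}^{-1}\begin{pmatrix}t\\ x\end{pmatrix}$, is bijective if and only if $X'$ is minimal.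
   Context: Random motion. Let $(W_n)_{n\ge 0}$ be random variables with $W_n\ge 0$ a.s. and $W_0=0$ a.s., let $T_n=\sum_{i=0}^n W_i$ and $N(t)=\max\{n\ge 0:\ T_n\le t\}$, with $N(t)<\infty$ a.s. for all $t\ge 0$. Let $V=\{V(t)\}_{t\ge 0}$ take values in a finite set of velocities in $\mathbb{R}^D$ and change value only when $N$ records an event, so $V(t)=V(T_{N(t)})$. The random motion with velocity $V$, whose displacements are governed by $N$, is $X(t)=\int_0^tV(s)\,ds$. A random motion in $\mathbb{R}^D$ is called minimal if it moves with $D+1$ affinely independent velocities $v_0,\dots,v_D\in\mathbb{R}^D$. "$X'$ has the same rule of changes of velocity as $X$ and $N'\stackrel{d}{=}N$" means that the probabilistic mechanism selecting the index $h$ of the current velocity is the same: if $J(t)$ (resp. $J'(t)$) is the index of the current velocity, so that $V(t)=v_{J(t)}$ and $V'(t)=v'_{J'(t)}$, then the pairs $(N,J)$ and $(N',J')$ have the same law as processes. $\stackrel{d}{=}$ denotes equality in distribution. *)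

theory Defs
  imports "HOL-Probability.Probability"
begin

definition event_time :: "(nat \<Rightarrow> 'a \<Rightarrow> real) \<Rightarrow> nat \<Rightarrow> 'a \<Rightarrow> real" where
  "event_time W n \<omega> = (\<Sum>i\<le>n. W i \<omega>)"

text \<open>The maximum is taken in the extended naturals, so that it is \<open>\<infinity>\<close> when infinitely many
  events occur up to time \<open>t\<close>.\<close>

definition counting :: "(nat \<Rightarrow> 'a \<Rightarrow> real) \<Rightarrow> real \<Rightarrow> 'a \<Rightarrow> enat" where
  "counting W t \<omega> = Sup (enat ` {n. event_time W n \<omega> \<le> t})"

definition motion :: "('k \<Rightarrow> real ^ 'd) \<Rightarrow> (real \<Rightarrow> 'a \<Rightarrow> 'k) \<Rightarrow> real \<Rightarrow> 'a \<Rightarrow> real ^ 'd" where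
  "motion v J t \<omega> = (LBINT s:{0..t}. v (J s \<omega>))"

text \<open>A random motion is given by the waiting times \<open>W\<close>, the index process \<open>J\<close> of the current
  velocity and the finite family \<open>v\<close> of velocities (not assumed distinct); the velocity process
  is \<open>V(t) = v (J t)\<close>. The last assumption says that the position is a random variable; since
  the path conditions only hold almost surely, it would be automatic only on a complete space.\<close>

locale random_motion = prob_space M
  for M :: "'a measure" +
  fixes W :: "nat \<Rightarrow> 'a \<Rightarrow> real"
    and J :: "real \<Rightarrow> 'a \<Rightarrow> 'k::finite"
    and v :: "'k \<Rightarrow> real ^ 'd::finite"
  assumes W_measurable: "\<And>n. random_variable borel (W n)"
    and W_nonneg: "\<And>n. AE \<omega> in M. 0 \<le> W n \<omega>"
    and W_0: "AE \<omega> in M. W 0 \<omega> = 0"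
    and counting_finite: "\<And>t. 0 \<le> t \<Longrightarrow> AE \<omega> in M. counting W t \<omega> < \<infinity>"
    and J_measurable: "\<And>t. 0 \<le> t \<Longrightarrow> random_variable (count_space UNIV) (J t)"
    and velocity_changes: "AE \<omega> in M. \<forall>t\<ge>0.
          v (J t \<omega>) = v (J (event_time W (the_enat (counting W t \<omega>)) \<omega>) \<omega>)"
    and motion_measurable: "\<And>t. 0 \<le> t \<Longrightarrow> random_variable borel (motion v J t)"

text \<open>Affine independence of the family \<open>v\<close>: as \<open>affine_dependent\<close> is a predicate on sets,
  repeated velocities have to be excluded separately.\<close>

locale minimal_random_motion = random_motion M W J v
  for M :: "'a measure"
    and W :: "nat \<Rightarrow> 'a \<Rightarrow> real"
    and J :: "real \<Rightarrow> 'a \<Rightarrow> 'k::finite"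
    and v :: "'k \<Rightarrow> real ^ 'd::finite" +
  assumes card_velocities: "CARD('k) = CARD('d) + 1"
    and inj_velocities: "inj v"
    and affinely_independent: "\<not> affine_dependent (range v)"

text \<open>Law of the process \<open>(N, J)\<close> on the product space over the time set \<open>[0, \<infinity>)\<close>.\<close>

definition switching_law ::
  "'a measure \<Rightarrow> (nat \<Rightarrow> 'a \<Rightarrow> real) \<Rightarrow> (real \<Rightarrow> 'a \<Rightarrow> 'k) \<Rightarrow> (real \<Rightarrow> enat \<times> 'k) measure" where
  "switching_law M W J =
     distr M (\<Pi>\<^sub>M t\<in>{0..}. count_space UNIV) (\<lambda>\<omega>. \<lambda>t\<in>{0..}. (counting W t \<omega>, J t \<omega>))"

text \<open>The index type \<open>'d option\<close> has \<open>D + 1\<close> elements when \<open>'d\<close> has \<open>D\<close>. Applied to a number and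
  a vector this puts an entry (at \<open>None\<close>) on top of a column; applied to a row and a matrix,
  which is a vector of rows, it puts a row on top of the matrix.\<close>

definition vcons :: "'b \<Rightarrow> 'b ^ 'd \<Rightarrow> 'b ^ ('d::finite) option" where
  "vcons a x = (\<chi> i. case i of None \<Rightarrow> a | Some j \<Rightarrow> x $ j)"

definition velocity_matrix :: "('k::finite \<Rightarrow> real ^ 'd) \<Rightarrow> real ^ 'k ^ 'd::finite" where
  "velocity_matrix v = (\<chi> i h. v h $ i)"

definition transfer_map ::
  "('d::finite option \<Rightarrow> real ^ 'd) \<Rightarrow> ('d option \<Rightarrow> real ^ 'd) \<Rightarrow> real \<Rightarrow> real ^ 'd \<Rightarrow> real ^ 'd" where
  "transfer_map v v' t x =
     (velocity_matrix v' ** matrix_inv (vcons (vec 1) (velocity_matrix v))) *v vcons t x"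

end

theory Submission
  imports Defs
begin

text \<open>
  Stack a row of ones on top of the velocities. The kernel of the resulting square matrix \<open>A\<close>
  consists of the affine relations between the velocities, so \<open>A\<close> is invertible exactly when they
  are affinely independent (\<open>invertible_velocities_iff\<close>). The vector \<open>(t, X(t))\<close> is \<open>A\<close> applied to
  the vector of occupation times of the velocities up to time \<open>t\<close>. So \<open>A\<inverse> (t, X(t))\<close> recovers the
  occupation times, and multiplying them by the new velocities gives, path by path, the position
  \<open>Y\<close> that the index process \<open>J\<close> of \<open>X\<close> would have produced with the new velocities
  (\<open>transfer_motion\<close>).

  It remains to see that \<open>Y\<close> and \<open>X'(t)\<close>, which live on different spaces, have the same law because
  \<open>(N, J)\<close> and \<open>(N', J')\<close> do. Both are integrals along a path, while the law on the product space
  determines only events that depend on countably many times. But almost every velocity path is a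
  function of the counting path, which is monotone with values in the naturals, so its Riemann sums
  converge (\<open>riemann_sum_tendsto\<close>). Hence each position is almost surely the limit of Riemann sums,
  and this limit is one fixed measurable functional of the process of counts and indices
  (\<open>distr_motion_eq_functional\<close>). The step property is needed for the velocities \<open>v'\<close> along both
  index processes: for \<open>J'\<close> it is part of the assumptions on \<open>X'\<close>, and for \<open>J\<close> it follows from
  that of \<open>v (J)\<close>, as minimality makes \<open>v\<close> injective.

  As for bijectivity, if both families are affinely independent then the transfer in the opposite
  direction is an inverse. If \<open>v'\<close> has a nontrivial affine relation \<open>c\<close>, then \<open>A c\<close> has the form
  \<open>(0, y)\<close> with \<open>y \<noteq> 0\<close>, and translating by \<open>y\<close> does not change the value of the transfer map
  (\<open>bij_transfer_map_iff\<close>).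
\<close>

section \<open>Affine independence and the transfer map\<close>

definition augmented :: "('k::finite \<Rightarrow> real ^ 'd) \<Rightarrow> real ^ 'k ^ ('d::finite) option" where
  "augmented v = vcons (vec 1) (velocity_matrix v)"

lemma vcons_nth [simp]: "vcons a x $ None = a" "vcons a x $ Some j = x $ j"
  by (simp_all add: vcons_def)

lemma vcons_eq_iff [simp]: "vcons a x = vcons b y \<longleftrightarrow> a = b \<and> x = y"
  by (metis vec_eq_iff vcons_nth)

lemma vcons_add: "vcons a x + vcons b y = vcons (a + b) (x + y)"
  by (simp add: vec_eq_iff vcons_def split: option.split)

lemma vcons_eq_0_iff [simp]: "vcons a x = 0 \<longleftrightarrow> a = 0 \<and> x = 0"
  by (metis vec_eq_iff vcons_nth zero_index option.exhaust)

lemma velocity_matrix_mult: "velocity_matrix v *v c = (\<Sum>h\<in>UNIV. c $ h *\<^sub>R v h)"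
  by (simp add: vec_eq_iff velocity_matrix_def matrix_vector_mult_def mult.commute)

lemma augmented_mult: "augmented v *v c = vcons (\<Sum>h\<in>UNIV. c $ h) (velocity_matrix v *v c)"
  by (simp add: augmented_def vec_eq_iff matrix_vector_mult_def vcons_def split: option.split)

lemma augmented_mult_axis: "augmented v *v axis h 1 = vcons 1 (v h)"
  by (simp add: augmented_def vec_eq_iff matrix_vector_mult_def vcons_def axis_def velocity_matrix_def
      if_distrib cong: if_cong split: option.split)

lemma velocity_matrix_mult_axis: "velocity_matrix v *v axis h 1 = v h"
  using augmented_mult_axis[of v h] unfolding augmented_mult by simp

text \<open>A kernel vector of \<open>augmented v\<close> is an affine relation between the velocities. Two equal
  velocities also give one, which is why injectivity appears next to \<open>affine_dependent\<close>.\<close>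

lemma invertible_velocities_iff:
  fixes v :: "'d::finite option \<Rightarrow> real ^ 'd"
  shows "invertible (augmented v) \<longleftrightarrow> inj v \<and> \<not> affine_dependent (range v)"
proof -
  have ker: "invertible (augmented v) \<longleftrightarrow>
      (\<forall>c. (\<Sum>h\<in>UNIV. c $ h) = 0 \<and> (\<Sum>h\<in>UNIV. c $ h *\<^sub>R v h) = 0 \<longrightarrow> c = 0)"
    unfolding invertible_left_inverse matrix_left_invertible_ker augmented_mult velocity_matrix_mult
    by simp
  show ?thesis
  proof (intro iffI conjI)
    assume inv: "invertible (augmented v)"
    show inj: "inj v"
    proof (rule injI)
      fix a b assume "v a = v b"
      then have "augmented v *v axis a 1 = augmented v *v axis b 1"
        by (simp only: augmented_mult_axis)
      then have "(axis a 1 :: real ^ 'd option) = axis b 1"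
        using inv by (metis invertible_def matrix_vector_mul_assoc matrix_vector_mul_lid)
      then show "a = b" by (simp add: axis_eq_axis)
    qed
    show "\<not> affine_dependent (range v)"
    proof
      assume "affine_dependent (range v)"
      then obtain U where U: "sum U (range v) = 0" "\<exists>x\<in>range v. U x \<noteq> 0"
          "(\<Sum>x\<in>range v. U x *\<^sub>R x) = 0"
        by (auto simp: affine_dependent_explicit_finite)
      define c where "c = (\<chi> h. U (v h))"
      have "(\<Sum>h\<in>UNIV. c $ h) = 0" "(\<Sum>h\<in>UNIV. c $ h *\<^sub>R v h) = 0"
        using U(1,3) by (simp_all add: c_def sum.reindex[OF inj])
      then have "c = 0" using inv ker by blast
      then show False using U(2) by (auto simp: c_def vec_eq_iff)
    qed
  next
    assume *: "inj v \<and> \<not> affine_dependent (range v)"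
    show "invertible (augmented v)" unfolding ker
    proof (intro allI impI)
      fix c :: "real ^ 'd option"
      assume c: "(\<Sum>h\<in>UNIV. c $ h) = 0 \<and> (\<Sum>h\<in>UNIV. c $ h *\<^sub>R v h) = 0"
      define U where "U x = c $ inv v x" for x
      have U: "U (v h) = c $ h" for h using * by (simp add: U_def)
      have "sum U (range v) = 0" "(\<Sum>x\<in>range v. U x *\<^sub>R x) = 0"
        using c * by (simp_all add: sum.reindex U)
      then have "\<forall>x\<in>range v. U x = 0"
        using * by (auto simp: affine_dependent_explicit_finite)
      then show "c = 0" by (auto simp: U vec_eq_iff)
    qed
  qed
qed

lemma matrix_inv_vector_mult:
  fixes A :: "real ^ 'n ^ 'n"
  assumes "invertible A"
  shows "A *v (matrix_inv A *v x) = x" "matrix_inv A *v (A *v x) = x"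
proof -
  have "A ** matrix_inv A = mat 1 \<and> matrix_inv A ** A = mat 1"
    using assms unfolding matrix_inv_def invertible_def by (rule someI_ex)
  then show "A *v (matrix_inv A *v x) = x" "matrix_inv A *v (A *v x) = x"
    by (simp_all add: matrix_vector_mul_assoc)
qed

lemma transfer_map_eq:
  "transfer_map v v' t x = velocity_matrix v' *v (matrix_inv (augmented v) *v vcons t x)"
  by (simp add: transfer_map_def augmented_def matrix_vector_mul_assoc)

text \<open>The transfer map leaves the first coordinate, the elapsed time, unchanged: both augmented
  matrices have the row of ones on top.\<close>

lemma vcons_transfer_map:
  assumes "invertible (augmented v)"
  shows "vcons t (transfer_map v v' t x) = augmented v' *v (matrix_inv (augmented v) *v vcons t x)"
proof -
  have "augmented v *v (matrix_inv (augmented v) *v vcons t x) = vcons t x"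
    by (simp add: matrix_inv_vector_mult assms)
  then have "(\<Sum>h\<in>UNIV. (matrix_inv (augmented v) *v vcons t x) $ h) = t"
    unfolding augmented_mult by simp
  then show ?thesis by (simp add: augmented_mult transfer_map_eq)
qed

lemma transfer_map_inverse:
  assumes "invertible (augmented v)" "invertible (augmented v')"
  shows "transfer_map v' v t (transfer_map v v' t x) = x"
proof -
  have "vcons t (transfer_map v' v t (transfer_map v v' t x)) = vcons t x"
    by (simp add: vcons_transfer_map matrix_inv_vector_mult assms)
  then show ?thesis by simp
qed

lemma bij_transfer_map_iff:
  assumes inv: "invertible (augmented v)"
  shows "bij (transfer_map v v' t) \<longleftrightarrow> invertible (augmented v')"
proof
  assume "invertible (augmented v')"
  then show "bij (transfer_map v v' t)"
    using inv by (intro o_bij[where g = "transfer_map v' v t"]) (auto simp: transfer_map_inverse)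
next
  assume bij: "bij (transfer_map v v' t)"
  show "invertible (augmented v')"
    unfolding invertible_left_inverse matrix_left_invertible_ker
  proof (intro allI impI)
    fix c assume "augmented v' *v c = 0"
    then have c: "(\<Sum>h\<in>UNIV. c $ h) = 0" "velocity_matrix v' *v c = 0"
      unfolding augmented_mult by simp_all
    \<comment> \<open>The velocities \<open>v\<close> give the displacement \<open>y\<close> to the signed occupation times \<open>c\<close>, of total
      zero, with which the velocities \<open>v'\<close> produce no displacement.\<close>
    define y where "y = velocity_matrix v *v c"
    have y: "vcons 0 y = augmented v *v c"
      by (simp add: augmented_mult c y_def)
    have "vcons t y = vcons t 0 + vcons 0 y" by (simp add: vcons_add)
    then have "transfer_map v v' t y = transfer_map v v' t 0"
      by (simp add: transfer_map_eq matrix_vector_right_distrib y c matrix_inv_vector_mult inv)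
    then have "y = 0" using bij by (simp add: bij_def inj_eq)
    then have "augmented v *v c = 0" by (simp flip: y)
    then show "c = 0"
      using matrix_inv_vector_mult(2)[OF inv, of c] by simp
  qed
qed

text \<open>Integrating \<open>vcons 1 (v (j s)) = augmented v *v axis (j s) 1\<close> over \<open>[0, t]\<close> yields
  \<open>vcons t\<close> of the displacement, and the transfer map, being linear in that vector, commutes with the
  integral.\<close>

lemma transfer_motion:
  fixes v v' :: "'d::finite option \<Rightarrow> real ^ 'd"
  assumes inv: "invertible (augmented v)" and t: "0 \<le> t"
    and int: "set_integrable lborel {0..t} (\<lambda>s. v (J s \<omega>))"
  shows "transfer_map v v' t (motion v J t \<omega>) = motion v' J t \<omega>"
proof -
  define L where "L = velocity_matrix v' ** matrix_inv (augmented v)"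
  have L: "L *v vcons 1 (v k) = v' k" for k
  proof -
    have "L *v vcons 1 (v k) = velocity_matrix v' *v (matrix_inv (augmented v) *v (augmented v *v axis k 1))"
      unfolding augmented_mult_axis by (simp add: L_def matrix_vector_mul_assoc)
    then show ?thesis by (simp add: matrix_inv_vector_mult inv velocity_matrix_mult_axis)
  qed
  define F where "F s = indicator {0..t} s *\<^sub>R vcons 1 (v (J s \<omega>))" for s
  have F_nth: "(\<lambda>s. F s $ None) = indicator {0..t}"
      "(\<lambda>s. F s $ Some j) = (\<lambda>s. (indicator {0..t} s *\<^sub>R v (J s \<omega>)) $ j)" for j
    by (auto simp: F_def)
  have intv: "integrable lborel (\<lambda>s. indicator {0..t} s *\<^sub>R v (J s \<omega>))"
    using int by (simp add: set_integrable_def)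
  have int_nth: "integrable lborel (\<lambda>s. F s $ i)" for i
  proof (cases i)
    case None
    then show ?thesis
      by (simp add: F_nth integrable_indicator_iff emeasure_lborel_Icc_eq)
  next
    case (Some j)
    show ?thesis unfolding Some F_nth
      by (rule integrable_bounded_linear[OF bounded_linear_vec_nth intv])
  qed
  have intF: "integrable lborel F"
  proof -
    have "integrable lborel (\<lambda>s. \<Sum>i\<in>UNIV. F s $ i *\<^sub>R axis i (1::real))"
      by (intro Bochner_Integration.integrable_sum integrable_scaleR_left) (use int_nth in auto)
    also have "(\<lambda>s. \<Sum>i\<in>UNIV. F s $ i *\<^sub>R axis i 1) = F"
      by (simp add: fun_eq_iff vec_eq_iff axis_def if_distrib cong: if_cong)
    finally show ?thesis .
  qed
  have F: "(LINT s|lborel. F s) = vcons t (motion v J t \<omega>)"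
  proof (subst vec_eq_iff, intro allI)
    fix i
    have "(LINT s|lborel. F s) $ i = (LINT s|lborel. F s $ i)"
      by (rule integral_bounded_linear[OF bounded_linear_vec_nth intF, symmetric])
    also have "\<dots> = vcons t (motion v J t \<omega>) $ i"
    proof (cases i)
      case None
      then show ?thesis using t by (simp add: F_nth)
    next
      case (Some j)
      show ?thesis unfolding Some F_nth
        by (subst integral_bounded_linear[OF bounded_linear_vec_nth intv])
          (simp add: motion_def set_lebesgue_integral_def)
    qed
    finally show "(LINT s|lborel. F s) $ i = vcons t (motion v J t \<omega>) $ i" .
  qed
  have "motion v' J t \<omega> = (LINT s|lborel. L *v F s)"
    by (simp add: motion_def set_lebesgue_integral_def F_def L scaleR_matrix_vector_assoc[symmetric]
        matrix_vector_mult_scaleR)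
  also have "\<dots> = L *v vcons t (motion v J t \<omega>)"
    unfolding F[symmetric]
    by (rule integral_bounded_linear[OF matrix_vector_mul_bounded_linear intF])
  finally show ?thesis by (simp add: transfer_map_def L_def augmented_def)
qed

lemma transfer_map_borel:
  fixes v v' :: "'d::finite option \<Rightarrow> real ^ 'd"
  shows "transfer_map v v' t \<in> borel_measurable borel"
proof -
  have "continuous_on UNIV (\<lambda>x::real^'d. vcons t x)"
    unfolding vcons_def
  proof (rule continuous_on_vec_lambda)
    fix i :: "'d option"
    show "continuous_on UNIV (\<lambda>x::real^'d. case i of None \<Rightarrow> t | Some j \<Rightarrow> x $ j)"
      by (cases i) (simp_all add: continuous_on_component)
  qed
  then have "continuous_on UNIV (\<lambda>x. transfer_map v v' t x)"
    unfolding transfer_map_def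
    by (rule continuous_on_compose2[OF matrix_vector_mult_linear_continuous_on _ subset_UNIV])
  then show ?thesis by (rule borel_measurable_continuous_onI)
qed

section \<open>Riemann sums of step paths\<close>

definition grid :: "nat \<Rightarrow> real \<Rightarrow> real" where
  "grid n s = real_of_int \<lfloor>real (Suc n) * s\<rfloor> / real (Suc n)"

lemma grid_tendsto: "(\<lambda>n. grid n s) \<longlonglongrightarrow> s"
proof -
  have "norm (grid n s - s) \<le> inverse (real (Suc n))" for n
  proof -
    have "grid n s - s = (real_of_int \<lfloor>real (Suc n) * s\<rfloor> - real (Suc n) * s) / real (Suc n)"
      by (simp add: grid_def diff_divide_distrib)
    also have "norm \<dots> \<le> 1 / real (Suc n)"
      unfolding real_norm_def abs_divide abs_of_nat
      by (intro divide_right_mono) linarith+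
    finally show ?thesis by (simp add: inverse_eq_divide)
  qed
  then have "(\<lambda>n. grid n s - s) \<longlonglongrightarrow> 0"
    by (intro Lim_null_comparison[OF always_eventually LIMSEQ_inverse_real_of_nat] allI)
  then show ?thesis by (simp add: LIM_zero_iff)
qed

lemma grid_le: "grid n s \<le> s"
  unfolding grid_def by (subst pos_divide_le_eq) (auto simp: mult.commute[of s])

lemma grid_nonneg: "0 \<le> s \<Longrightarrow> 0 \<le> grid n s"
  by (simp add: grid_def)

lemma grid_borel [measurable]: "grid n \<in> borel_measurable borel"
  unfolding grid_def[abs_def] by measurable

text \<open>The weight of a grid point is left as the measure of the set of times that are rounded to it:
  it matters only that it is a constant.\<close>

definition riemann_sum :: "nat \<Rightarrow> real \<Rightarrow> (real \<Rightarrow> 'b::real_vector) \<Rightarrow> 'b" where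
  "riemann_sum n t f = (\<Sum>k\<le>nat \<lfloor>real (Suc n) * t\<rfloor>.
     measure lborel {s\<in>{0..t}. \<lfloor>real (Suc n) * s\<rfloor> = int k} *\<^sub>R f (real k / real (Suc n)))"

lemma integral_grid_eq_riemann_sum:
  fixes f :: "real \<Rightarrow> 'b::{banach, second_countable_topology}"
  shows "(LBINT s:{0..t}. f (grid n s)) = riemann_sum n t f"
proof -
  define A where "A k = {s\<in>{0..t}. \<lfloor>real (Suc n) * s\<rfloor> = int k}" for k
  have A_sets: "A k \<in> sets lborel" for k
  proof -
    have "{s\<in>space borel. s \<in> {0..t} \<and> \<lfloor>real (Suc n) * s\<rfloor> = int k} \<in> sets borel" by measurable
    then show ?thesis by (simp add: A_def)
  qed
  have "emeasure lborel (A k) \<le> emeasure lborel {0..t}" for k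
    by (intro emeasure_mono) (auto simp: A_def)
  then have A_fin: "emeasure lborel (A k) < \<infinity>" for k
    by (rule le_less_trans) (simp add: emeasure_lborel_Icc_eq)
  have eq: "indicator {0..t} s *\<^sub>R f (grid n s) =
      (\<Sum>k\<le>nat \<lfloor>real (Suc n) * t\<rfloor>. indicator (A k) s *\<^sub>R f (real k / real (Suc n)))" for s
  proof (cases "s \<in> {0..t}")
    case False
    then have "indicator (A k) s = (0::real)" for k by (auto simp: A_def)
    then show ?thesis using False by simp
  next
    case True
    define m where "m = nat \<lfloor>real (Suc n) * s\<rfloor>"
    have m: "\<lfloor>real (Suc n) * s\<rfloor> = int m" using True by (simp add: m_def)
    have "m \<le> nat \<lfloor>real (Suc n) * t\<rfloor>"
      unfolding m_def using True by (intro nat_mono floor_mono mult_left_mono) auto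
    moreover have "(indicator (A k) s :: real) = (if k = m then 1 else 0)" for k
      using True m by (auto simp: A_def indicator_def)
    ultimately have "(\<Sum>k\<le>nat \<lfloor>real (Suc n) * t\<rfloor>. indicator (A k) s *\<^sub>R f (real k / real (Suc n)))
        = f (real m / real (Suc n))"
      by (simp add: if_distrib[of "\<lambda>x. x *\<^sub>R _"] cong: if_cong)
    then show ?thesis using True by (simp only: grid_def m) simp
  qed
  have "(LBINT s:{0..t}. f (grid n s)) =
      (\<Sum>k\<le>nat \<lfloor>real (Suc n) * t\<rfloor>. LINT s|lborel. indicator (A k) s *\<^sub>R f (real k / real (Suc n)))"
    unfolding set_lebesgue_integral_def eq
    using A_sets A_fin by (intro Bochner_Integration.integral_sum integrable_scaleR_left) auto
  also have "\<dots> = riemann_sum n t f"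
    unfolding riemann_sum_def A_def[symmetric] using A_sets A_fin
    by (intro sum.cong refl) (subst integral_scaleR_left, auto)
  finally show ?thesis .
qed

lemma mono_nat_borel:
  assumes "mono (c :: real \<Rightarrow> nat)"
  shows "c \<in> borel \<rightarrow>\<^sub>M count_space UNIV"
proof -
  have "(\<lambda>s. real (c s)) \<in> borel_measurable borel"
    using assms by (intro borel_measurable_mono) (auto simp: mono_def)
  then have "(\<lambda>s. nat \<lfloor>real (c s)\<rfloor>) \<in> borel \<rightarrow>\<^sub>M count_space UNIV" by measurable
  then show ?thesis by simp
qed

lemma set_integrable_step:
  fixes h :: "nat \<Rightarrow> 'b::{banach, second_countable_topology}"
  assumes c: "mono (c :: real \<Rightarrow> nat)" and f: "\<And>s. s \<in> {0..t} \<Longrightarrow> f s = h (c s)"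
  shows "set_integrable lborel {0..t} f"
proof -
  note mono_nat_borel[OF c, measurable]
  have *: "norm (h (c s)) \<le> (\<Sum>k\<le>c t. norm (h k))" if "s \<in> {0..t}" for s
    using that monoD[OF c, of s t] by (intro member_le_sum) auto
  have "set_integrable lborel {0..t} (\<lambda>s. h (c s))"
    unfolding set_integrable_def
  proof (rule Bochner_Integration.integrable_bound[
        where f = "\<lambda>s. indicator {0..t} s * (\<Sum>k\<le>c t. norm (h k))", OF _ _ AE_I2])
    show "integrable lborel (\<lambda>s. indicator {0..t} s * (\<Sum>k\<le>c t. norm (h k)))"
      by (simp add: emeasure_lborel_Icc_eq)
    show "norm (indicator {0..t} s *\<^sub>R h (c s))
        \<le> norm (indicator {0..t} s * (\<Sum>k\<le>c t. norm (h k)))" for s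
      using *[of s] by (auto simp: indicator_def)
  qed measurable
  then show ?thesis
    by (subst set_integrable_cong[OF refl refl f])
qed

text \<open>A monotone real function has at most countably many discontinuities, and where an integer-valued
  one is continuous it is locally constant. So rounding the time to the grid eventually does not
  change the value of the path, for almost every time, and dominated convergence applies.\<close>

lemma riemann_sum_tendsto:
  fixes h :: "nat \<Rightarrow> 'b::{banach, second_countable_topology}"
  assumes c: "mono (c :: real \<Rightarrow> nat)" and f: "\<And>s. s \<in> {0..t} \<Longrightarrow> f s = h (c s)"
  shows "(\<lambda>n. riemann_sum n t f) \<longlonglongrightarrow> (LBINT s:{0..t}. f s)"
proof -
  have mono: "mono (\<lambda>s. real (c s))" using c by (auto simp: mono_def)
  note mono_nat_borel[OF c, measurable]
  have bound: "norm (h (c s)) \<le> (\<Sum>k\<le>c t. norm (h k))" if "s \<le> t" for s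
    using that monoD[OF c, of s t] by (intro member_le_sum) auto
  have "AE s in lborel. s \<notin> {s. \<not> isCont (\<lambda>s. real (c s)) s}"
    by (intro AE_not_in countable_imp_null_set_lborel mono_ctble_discont mono)
  then have conv: "AE s in lborel. (\<lambda>n. indicator {0..t} s *\<^sub>R h (c (grid n s)))
      \<longlonglongrightarrow> indicator {0..t} s *\<^sub>R h (c s)"
  proof eventually_elim
    case (elim s)
    then have "(\<lambda>n. real (c (grid n s))) \<longlonglongrightarrow> real (c s)"
      by (intro isCont_tendsto_compose[OF _ grid_tendsto]) auto
    then have "eventually (\<lambda>n. dist (real (c (grid n s))) (real (c s)) < 1) sequentially"
      by (rule tendstoD) simp
    then have "eventually (\<lambda>n. indicator {0..t} s *\<^sub>R h (c (grid n s)) =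
        indicator {0..t} s *\<^sub>R h (c s)) sequentially"
    proof eventually_elim
      case (elim n)
      then have "c (grid n s) = c s" unfolding dist_real_def by linarith
      then show ?case by simp
    qed
    then show ?case by (rule tendsto_eventually)
  qed
  have "(\<lambda>n. LINT s|lborel. indicator {0..t} s *\<^sub>R h (c (grid n s)))
      \<longlonglongrightarrow> (LINT s|lborel. indicator {0..t} s *\<^sub>R h (c s))"
  proof (rule integral_dominated_convergence[OF _ _ _ conv])
    show "integrable lborel (\<lambda>s. indicator {0..t} s *\<^sub>R (\<Sum>k\<le>c t. norm (h k)))"
      by (simp add: emeasure_lborel_Icc_eq)
    show "AE s in lborel. norm (indicator {0..t} s *\<^sub>R h (c (grid n s)))
        \<le> indicator {0..t} s *\<^sub>R (\<Sum>k\<le>c t. norm (h k))" for n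
      using bound order_trans[OF grid_le] by (intro AE_I2) (auto simp: indicator_def)
  qed measurable
  also have "(\<lambda>n. LINT s|lborel. indicator {0..t} s *\<^sub>R h (c (grid n s))) = (\<lambda>n. riemann_sum n t f)"
    unfolding integral_grid_eq_riemann_sum[symmetric] set_lebesgue_integral_def
    using f order_trans[OF grid_le] grid_nonneg
    by (intro ext Bochner_Integration.integral_cong refl) (auto simp: indicator_def)
  also have "(LINT s|lborel. indicator {0..t} s *\<^sub>R h (c s)) = (LBINT s:{0..t}. f s)"
    unfolding set_lebesgue_integral_def using f
    by (intro Bochner_Integration.integral_cong refl) (auto simp: indicator_def)
  finally show ?thesis .
qed

section \<open>The position as a functional of the switching process\<close>

lemma counting_mono: "s \<le> t \<Longrightarrow> counting W s \<omega> \<le> counting W t \<omega>"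
  unfolding counting_def by (intro Sup_subset_mono image_mono) auto

text \<open>Capping the count at its value at time \<open>t\<close> makes it finite, and monotone, on the whole line.\<close>

lemma step_path:
  assumes fin: "counting W t \<omega> < \<infinity>"
    and path: "\<forall>s\<ge>0. g (J s \<omega>) = g (J (event_time W (the_enat (counting W s \<omega>)) \<omega>) \<omega>)"
  shows "\<exists>(c :: real \<Rightarrow> nat) h. mono c \<and> (\<forall>s\<in>{0..t}. g (J s \<omega>) = h (c s))"
proof (intro exI conjI ballI)
  define m where "m s = min (counting W s \<omega>) (counting W t \<omega>)" for s
  have m_fin: "m s < \<infinity>" for s using fin unfolding m_def by (rule min.strict_coboundedI2)
  show "mono (\<lambda>s. the_enat (m s))"
  proof (rule monoI)
    fix r s :: real assume "r \<le> s"
    then have "m r \<le> m s"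
      unfolding m_def by (intro min.mono counting_mono order_refl)
    then show "the_enat (m r) \<le> the_enat (m s)"
      using m_fin[of r] m_fin[of s] by auto
  qed
  show "g (J s \<omega>) = (\<lambda>k. g (J (event_time W k \<omega>) \<omega>)) (the_enat (m s))" if "s \<in> {0..t}" for s
    using that path counting_mono[of s t W \<omega>] by (simp add: m_def min_absorb1)
qed

context random_motion
begin

lemma counting_measurable: "counting W t \<in> M \<rightarrow>\<^sub>M count_space UNIV"
proof -
  note W_measurable [measurable]
  have eq: "counting W t = (\<lambda>\<omega>. SUP n. if event_time W n \<omega> \<le> t then enat n else 0)"
  proof (intro ext antisym)
    fix \<omega>
    show "counting W t \<omega> \<le> (SUP n. if event_time W n \<omega> \<le> t then enat n else 0)"
      unfolding counting_def
    proof (rule SUP_least)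
      fix n assume "n \<in> {n. event_time W n \<omega> \<le> t}"
      then show "enat n \<le> (SUP n. if event_time W n \<omega> \<le> t then enat n else 0)"
        by (intro SUP_upper2[of n]) auto
    qed
    show "(SUP n. if event_time W n \<omega> \<le> t then enat n else 0) \<le> counting W t \<omega>"
      unfolding counting_def by (rule SUP_least) (auto intro: Sup_upper)
  qed
  have [measurable]: "event_time W n \<in> borel_measurable M" for n
    unfolding event_time_def[abs_def] by measurable
  show ?thesis unfolding eq by (intro measurable_SUP) measurable
qed

lemma switching_measurable:
  "(\<lambda>\<omega>. \<lambda>t\<in>{0..}. (counting W t \<omega>, J t \<omega>)) \<in> M \<rightarrow>\<^sub>M (\<Pi>\<^sub>M t\<in>{0::real..}. count_space UNIV)"
proof (rule measurable_restrict)
  fix t :: real assume "t \<in> {0..}"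
  then have "J t \<in> M \<rightarrow>\<^sub>M count_space UNIV" using J_measurable by simp
  then have "(\<lambda>\<omega>. (counting W t \<omega>, J t \<omega>)) \<in> M \<rightarrow>\<^sub>M count_space UNIV \<Otimes>\<^sub>M count_space UNIV"
    using counting_measurable by (rule measurable_Pair[rotated])
  then show "(\<lambda>\<omega>. (counting W t \<omega>, J t \<omega>)) \<in> M \<rightarrow>\<^sub>M count_space UNIV"
    by (simp add: pair_measure_countable)
qed

end

text \<open>On paths along which the Riemann sums diverge the value is arbitrary, but \<open>lim\<close> keeps the
  functional measurable on the whole product space.\<close>

definition limit_position :: "('k::finite \<Rightarrow> real ^ 'd) \<Rightarrow> real \<Rightarrow> (real \<Rightarrow> enat \<times> 'k) \<Rightarrow> real ^ 'd::finite"
  where "limit_position g t z = lim (\<lambda>n. riemann_sum n t (\<lambda>s. g (snd (z s))))"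

lemma limit_position_measurable:
  "limit_position g t \<in> (\<Pi>\<^sub>M s\<in>{0..}. count_space UNIV) \<rightarrow>\<^sub>M borel"
proof -
  have [measurable]: "(\<lambda>z. g (snd (z s))) \<in> (\<Pi>\<^sub>M s\<in>{0..}. count_space UNIV) \<rightarrow>\<^sub>M borel"
    if "0 \<le> s" for s :: real
    using that
    by (intro measurable_compose[OF measurable_component_singleton[of s]]) auto
  show ?thesis
    unfolding limit_position_def[abs_def] riemann_sum_def
    by (intro borel_measurable_lim_metric borel_measurable_sum borel_measurable_scaleR
        borel_measurable_const) simp_all
qed

lemma limit_position_eq:
  fixes g :: "'k::finite \<Rightarrow> real ^ 'd::finite"
  assumes "counting W t \<omega> < \<infinity>"
    and "\<forall>s\<ge>0. g (J s \<omega>) = g (J (event_time W (the_enat (counting W s \<omega>)) \<omega>) \<omega>)"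
  shows "limit_position g t (\<lambda>s\<in>{0..}. (counting W s \<omega>, J s \<omega>)) = motion g J t \<omega>"
proof -
  obtain c :: "real \<Rightarrow> nat" and h
    where "mono c" "\<And>s. s \<in> {0..t} \<Longrightarrow> g (J s \<omega>) = h (c s)"
    using step_path[of W t \<omega> g J, OF assms] by blast
  then have "(\<lambda>n. riemann_sum n t (\<lambda>s. g (J s \<omega>))) \<longlonglongrightarrow> motion g J t \<omega>"
    unfolding motion_def by (rule riemann_sum_tendsto)
  then show ?thesis
    by (simp add: limit_position_def riemann_sum_def limI)
qed

text \<open>Almost surely the position is \<open>limit_position\<close> of the path of \<open>(N, J)\<close>, and the law of a
  measurable functional of a process is the image of the law of the process. The velocity map \<open>g\<close>
  is arbitrary because the lemma is applied to the index process of one motion with the velocities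
  of another; \<open>Y\<close> is a version of the position, whose integral form is known to be measurable only
  for the velocities \<open>v\<close>.\<close>

lemma (in random_motion) distr_motion_eq_functional:
  fixes g :: "'k \<Rightarrow> real ^ 'd"
  assumes t: "0 \<le> t"
    and path: "AE \<omega> in M. \<forall>s\<ge>0. g (J s \<omega>) = g (J (event_time W (the_enat (counting W s \<omega>)) \<omega>) \<omega>)"
    and Y: "random_variable borel Y" "AE \<omega> in M. Y \<omega> = motion g J t \<omega>"
  shows "distr M borel Y = distr (switching_law M W J) borel (limit_position g t)"
proof -
  have "distr M borel Y =
      distr M borel (\<lambda>\<omega>. limit_position g t (\<lambda>s\<in>{0..}. (counting W s \<omega>, J s \<omega>)))"
  proof (rule distr_cong_AE)
    show "AE \<omega> in M. Y \<omega> = limit_position g t (\<lambda>s\<in>{0..}. (counting W s \<omega>, J s \<omega>))"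
      using Y(2) path counting_finite[OF t]
    proof eventually_elim
      case (elim \<omega>)
      then show ?case using limit_position_eq[of W t \<omega> g J] by simp
    qed
    show "(\<lambda>\<omega>. limit_position g t (\<lambda>s\<in>{0..}. (counting W s \<omega>, J s \<omega>))) \<in> M \<rightarrow>\<^sub>M borel"
      by (rule measurable_compose[OF switching_measurable limit_position_measurable])
  qed (use Y in auto)
  also have "\<dots> = distr (switching_law M W J) borel (limit_position g t)"
    unfolding switching_law_def
    by (subst distr_distr[OF limit_position_measurable switching_measurable]) (simp add: comp_def)
  finally show ?thesis .
qed

section \<open>Transfer between random motions\<close>

theorem theorem2p1:
  fixes M :: "'a measure" and M' :: "'b measure"
    and W :: "nat \<Rightarrow> 'a \<Rightarrow> real" and W' :: "nat \<Rightarrow> 'b \<Rightarrow> real"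
    and J :: "real \<Rightarrow> 'a \<Rightarrow> 'd::finite option" and J' :: "real \<Rightarrow> 'b \<Rightarrow> 'd option"
    and v v' :: "'d option \<Rightarrow> real ^ 'd"
    and t :: real
  assumes "minimal_random_motion M W J v"
    and "random_motion M' W' J' v'"
    and "switching_law M' W' J' = switching_law M W J"
    and "t \<ge> 0"
  shows "invertible (vcons (vec 1) (velocity_matrix v))
    \<and> distr M' borel (motion v' J' t) = distr M borel (\<lambda>\<omega>. transfer_map v v' t (motion v J t \<omega>))
    \<and> (bij (transfer_map v v' t) \<longleftrightarrow> minimal_random_motion M' W' J' v')"
proof -
  interpret X: minimal_random_motion M W J v by fact
  interpret X': random_motion M' W' J' v' by fact
  have inv: "invertible (augmented v)"
    by (simp add: invertible_velocities_iff X.inj_velocities X.affinely_independent)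
  have transfer: "AE \<omega> in M. transfer_map v v' t (motion v J t \<omega>) = motion v' J t \<omega>"
    using X.velocity_changes X.counting_finite[OF \<open>t \<ge> 0\<close>]
  proof eventually_elim
    case (elim \<omega>)
    obtain c :: "real \<Rightarrow> nat" and h
      where "mono c" "\<And>s. s \<in> {0..t} \<Longrightarrow> v (J s \<omega>) = h (c s)"
      using step_path[of W t \<omega> v J, OF elim(2,1)] by blast
    then have "set_integrable lborel {0..t} (\<lambda>s. v (J s \<omega>))" by (rule set_integrable_step)
    then show ?case using inv \<open>t \<ge> 0\<close> by (intro transfer_motion)
  qed
  have "distr M' borel (motion v' J' t) = distr (switching_law M' W' J') borel (limit_position v' t)"
    using \<open>t \<ge> 0\<close> X'.velocity_changes X'.motion_measurable
    by (intro X'.distr_motion_eq_functional) auto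
  also have "\<dots> = distr (switching_law M W J) borel (limit_position v' t)"
    by (simp add: assms(3))
  also have "\<dots> = distr M borel (\<lambda>\<omega>. transfer_map v v' t (motion v J t \<omega>))"
  proof (rule X.distr_motion_eq_functional[symmetric, OF \<open>t \<ge> 0\<close> _ _ transfer])
    show "AE \<omega> in M. \<forall>s\<ge>0. v' (J s \<omega>) = v' (J (event_time W (the_enat (counting W s \<omega>)) \<omega>) \<omega>)"
      using X.velocity_changes by eventually_elim (simp add: inj_eq[OF X.inj_velocities])
    show "(\<lambda>\<omega>. transfer_map v v' t (motion v J t \<omega>)) \<in> borel_measurable M"
      by (rule measurable_compose[OF X.motion_measurable[OF \<open>t \<ge> 0\<close>] transfer_map_borel])
  qed
  finally have law: "distr M' borel (motion v' J' t) =
      distr M borel (\<lambda>\<omega>. transfer_map v v' t (motion v J t \<omega>))" .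
  have "minimal_random_motion M' W' J' v' \<longleftrightarrow> inj v' \<and> \<not> affine_dependent (range v')"
    using X'.random_motion_axioms
    by (auto simp: minimal_random_motion_def minimal_random_motion_axioms_def)
  then have "bij (transfer_map v v' t) \<longleftrightarrow> minimal_random_motion M' W' J' v'"
    by (simp add: bij_transfer_map_iff[OF inv] invertible_velocities_iff)
  with inv law show ?thesis unfolding augmented_def by blast
qed

end
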